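(* Let $r\ge2$ and let $f_1,f_2,\dots,f_r\colon X\to Y$ be fibrewise maps over $B$. Then $$D_B(f_1,\dots,f_r)=\mathrm{secat}_B(\widetilde{\Pi}_{r,Y}),$$ where $\widetilde{\Pi}_{r,Y}\colon \mathcal{P}_B(f_1,\dots,f_r)\to X$ is the pullback of $\Pi_{r,Y}\colon P_B(Y)\to Y_B^r$ along $(f_1,\dots,f_r)\colon X\to Y_B^r$.
   Context: All spaces are topological spaces, all maps are continuous, $I=[0,1]$. A fibrewise space over $B$ is a space $X$ with a map $p_X\colon X\to B$; a fibrewise map $f\colon X\to Y$ satisfies $p_Y\circ f=p_X$. Subspaces are fibrewise by restriction. $f\simeq_B g$ means there is $H\colon X\times I\to Y$ with $p_Y(H(x,t))=p_X(x)$, $H(\cdot,0)=f$, $H(\cdot,1)=g$. $D_B(f_1,\dots,f_r)$ is the least $n\ge 0$ (or $\infty$) such that $X$ has an open cover $\{U_0,\dots,U_n\}$ with $f_s|_{U_i}\simeq_B f_t|_{U_i}$ for all $0\le i\le n$, $1\le s,t\le r$. For a fibrewise map $f\colon E\to X$, $\mathrm{secat}_B(f)$ is the least $k\ge 0$ (or $\infty$) such that $X$ has an open cover $\{U_0,\dots,U_k\}$ where for each $i$ there is a fibrewise map $s_i\colon U_i\to E$ with $f\circ s_i\simeq_B i_{U_i}$ (inclusion). $Y_B^r$ is the $r$-fold fibred product of $Y$ over $B$. $P_B(Y)=\{(b,\alpha)\in B\times Y^I\mid p_Y\circ\alpha \text{ is constant at } b\}$ (compact-open topology on $Y^I$), projection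 $(b,\alpha)\mapsto b$; $\Pi_{r,Y}(b,\gamma)=(\gamma(0),\gamma(\tfrac1{r-1}),\dots,\gamma(1))$. Explicitly $\mathcal{P}_B(f_1,\dots,f_r)=\{(x,(b,\gamma))\in X\times P_B(Y)\mid f_{i+1}(x)=\gamma(\tfrac{i}{r-1}),\ i=0,\dots,r-1\}$ and $\widetilde{\Pi}_{r,Y}(x,(b,\gamma))=x$. *)

theory Defs
  imports "HOL-Analysis.Analysis" "HOL-Library.Extended_Nat"
begin

section \<open>Fibrewise spaces, maps and homotopies\<close>

text \<open>
  A fibrewise space over \<open>B\<close> is a topology \<open>X\<close> with a projection \<open>p\<close>. A subset \<open>U\<close> of \<open>X\<close> is the
  fibrewise space \<open>subtopology X U\<close> with the same \<open>p\<close>.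
\<close>

definition fibrewise_space :: "'b topology \<Rightarrow> 'x topology \<Rightarrow> ('x \<Rightarrow> 'b) \<Rightarrow> bool" where
  "fibrewise_space B X p \<longleftrightarrow> continuous_map X B p"

definition fibrewise_map ::
  "'x topology \<Rightarrow> ('x \<Rightarrow> 'b) \<Rightarrow> 'y topology \<Rightarrow> ('y \<Rightarrow> 'b) \<Rightarrow> ('x \<Rightarrow> 'y) \<Rightarrow> bool" where
  "fibrewise_map X pX Y pY f \<longleftrightarrow>
     continuous_map X Y f \<and> (\<forall>x\<in>topspace X. pY (f x) = pX x)"

text \<open>
  The property is imposed on every stage \<open>H(t, -)\<close> of the homotopy (the library puts the
  parameter first), i.e. it says \<open>pY (H (t, x)) = pX x\<close>.
\<close>

definition fibrewise_homotopic ::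
  "'x topology \<Rightarrow> ('x \<Rightarrow> 'b) \<Rightarrow> 'y topology \<Rightarrow> ('y \<Rightarrow> 'b) \<Rightarrow> ('x \<Rightarrow> 'y) \<Rightarrow> ('x \<Rightarrow> 'y) \<Rightarrow> bool" where
  "fibrewise_homotopic X pX Y pY f g \<longleftrightarrow>
     homotopic_with (\<lambda>h. \<forall>x\<in>topspace X. pY (h x) = pX x) X Y f g"

text \<open>
  Outside \<open>topspace X\<close> the values of \<open>f\<close> and \<open>g\<close> are irrelevant, although
  \<^const>\<open>homotopic_with\<close> constrains the homotopy at \<open>0\<close> and \<open>1\<close> on the whole type.
\<close>

lemma fibrewise_homotopic_iff:
  "fibrewise_homotopic X pX Y pY f g \<longleftrightarrow>
     (\<exists>H. continuous_map (prod_topology X (top_of_set {0..1::real})) Y H \<and>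
          (\<forall>x\<in>topspace X. \<forall>t\<in>{0..1}. pY (H (x, t)) = pX x) \<and>
          (\<forall>x\<in>topspace X. H (x, 0) = f x) \<and> (\<forall>x\<in>topspace X. H (x, 1) = g x))"
  (is "?L \<longleftrightarrow> ?R")
proof
  assume ?L
  then obtain h where h: "continuous_map (prod_topology (top_of_set {0..1::real}) X) Y h"
      "\<forall>x. h (0, x) = f x" "\<forall>x. h (1, x) = g x"
      "\<forall>t\<in>{0..1}. \<forall>x\<in>topspace X. pY (h (t, x)) = pX x"
    unfolding fibrewise_homotopic_def homotopic_with_def by auto
  have "continuous_map (prod_topology X (top_of_set {0..1::real})) Y (h \<circ> (\<lambda>z. (snd z, fst z)))"
    by (rule continuous_map_compose[OF _ h(1)])
       (simp add: continuous_map_pairwise o_def continuous_map_fst continuous_map_snd)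
  then show ?R using h(2-) by (intro exI[of _ "h \<circ> (\<lambda>z. (snd z, fst z))"]) auto
next
  assume ?R
  then obtain H where H: "continuous_map (prod_topology X (top_of_set {0..1::real})) Y H"
      "\<forall>x\<in>topspace X. \<forall>t\<in>{0..1}. pY (H (x, t)) = pX x"
      "\<forall>x\<in>topspace X. H (x, 0) = f x" "\<forall>x\<in>topspace X. H (x, 1) = g x"
    by auto
  define h where "h = (\<lambda>z. if snd z \<in> topspace X then H (snd z, fst z)
     else if fst z = (0::real) then f (snd z) else g (snd z))"
  have "continuous_map (prod_topology (top_of_set {0..1::real}) X) Y (H \<circ> (\<lambda>z. (snd z, fst z)))"
    by (rule continuous_map_compose[OF _ H(1)])
       (simp add: continuous_map_pairwise o_def continuous_map_fst continuous_map_snd)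
  then have "continuous_map (prod_topology (top_of_set {0..1::real}) X) Y h"
    by (rule continuous_map_eq) (auto simp: h_def)
  then show ?L
    unfolding fibrewise_homotopic_def homotopic_with_def
    using H(2-) by (intro exI[of _ h]) (auto simp: h_def)
qed

definition open_cover_upto :: "'x topology \<Rightarrow> nat \<Rightarrow> (nat \<Rightarrow> 'x set) \<Rightarrow> bool" where
  "open_cover_upto X n U \<longleftrightarrow> (\<forall>i\<le>n. openin X (U i)) \<and> (\<Union>i\<le>n. U i) = topspace X"


section \<open>Fibrewise distance and fibrewise sectional category\<close>

text \<open>In \<^typ>\<open>enat\<close> the infimum of a set is its least element, and \<open>\<infinity>\<close> if the set is empty.\<close>

definition fibrewise_distance ::
  "'x topology \<Rightarrow> ('x \<Rightarrow> 'b) \<Rightarrow> 'y topology \<Rightarrow> ('y \<Rightarrow> 'b) \<Rightarrow> nat \<Rightarrow> (nat \<Rightarrow> 'x \<Rightarrow> 'y) \<Rightarrow> enat" where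
  "fibrewise_distance X pX Y pY r f =
     Inf (enat ` {n. \<exists>U. open_cover_upto X n U \<and>
       (\<forall>i\<le>n. \<forall>s\<in>{1..r}. \<forall>t\<in>{1..r}.
          fibrewise_homotopic (subtopology X (U i)) pX Y pY (f s) (f t))})"

definition fibrewise_secat ::
  "'e topology \<Rightarrow> ('e \<Rightarrow> 'b) \<Rightarrow> 'x topology \<Rightarrow> ('x \<Rightarrow> 'b) \<Rightarrow> ('e \<Rightarrow> 'x) \<Rightarrow> enat" where
  "fibrewise_secat E pE X pX f =
     Inf (enat ` {k. \<exists>U. open_cover_upto X k U \<and>
       (\<forall>i\<le>k. \<exists>s. fibrewise_map (subtopology X (U i)) pX E pE s \<and>
          fibrewise_homotopic (subtopology X (U i)) pX X pX (f \<circ> s) (\<lambda>x. x))})"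


section \<open>Fibred powers and the fibrewise path space\<close>

text \<open>The \<open>r\<close>-fold fibred product; points are extensional tuples indexed by \<open>{1..r}\<close>.\<close>

definition fibred_power :: "'y topology \<Rightarrow> ('y \<Rightarrow> 'b) \<Rightarrow> nat \<Rightarrow> (nat \<Rightarrow> 'y) topology" where
  "fibred_power Y pY r =
     subtopology (product_topology (\<lambda>_. Y) {1..r})
       {y. \<forall>i\<in>{1..r}. \<forall>j\<in>{1..r}. pY (y i) = pY (y j)}"

definition tuple_map :: "nat \<Rightarrow> (nat \<Rightarrow> 'x \<Rightarrow> 'y) \<Rightarrow> 'x \<Rightarrow> (nat \<Rightarrow> 'y)" where
  "tuple_map r f x = (\<lambda>i\<in>{1..r}. f i x)"

text \<open>
  Maps are represented extensionally, so that two elements of the mapping space are equal iff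
  they agree on \<open>topspace X\<close>.
\<close>

definition mapping_space :: "'x topology \<Rightarrow> 'y topology \<Rightarrow> ('x \<Rightarrow> 'y) set" where
  "mapping_space X Y = {f \<in> extensional (topspace X). continuous_map X Y f}"

definition compact_open_topology :: "'x topology \<Rightarrow> 'y topology \<Rightarrow> ('x \<Rightarrow> 'y) topology" where
  "compact_open_topology X Y =
     topology_generated_by
       {{f \<in> mapping_space X Y. f ` K \<subseteq> V} | K V. compactin X K \<and> openin Y V}"

definition path_space :: "'b topology \<Rightarrow> 'y topology \<Rightarrow> ('y \<Rightarrow> 'b) \<Rightarrow> ('b \<times> (real \<Rightarrow> 'y)) topology" where
  "path_space B Y pY =
     subtopology (prod_topology B (compact_open_topology (top_of_set {0..1}) Y))
       {(b, \<gamma>). \<forall>t\<in>{0..1}. pY (\<gamma> t) = b}"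

text \<open>The component with index \<open>i \<in> {1..r}\<close> is \<open>\<gamma> ((i - 1) / (r - 1))\<close>.\<close>

definition path_eval :: "nat \<Rightarrow> 'b \<times> (real \<Rightarrow> 'y) \<Rightarrow> (nat \<Rightarrow> 'y)" where
  "path_eval r = (\<lambda>(b, \<gamma>). \<lambda>i\<in>{1..r}. \<gamma> ((real i - 1) / (real r - 1)))"


section \<open>The pullback of the path fibration\<close>

text \<open>
  The pullback of \<open>q : E \<rightarrow> Z\<close> along \<open>g : X \<rightarrow> Z\<close>. As a subspace of the product \<open>X \<times> E\<close> it does not
  depend on the topology of \<open>Z\<close>; the map induced by \<open>q\<close> is \<^const>\<open>fst\<close>.
\<close>

definition pullback_space ::
  "'x topology \<Rightarrow> 'e topology \<Rightarrow> ('x \<Rightarrow> 'z) \<Rightarrow> ('e \<Rightarrow> 'z) \<Rightarrow> ('x \<times> 'e) topology" where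
  "pullback_space X E g q = subtopology (prod_topology X E) {(x, e). g x = q e}"

definition path_pullback ::
  "'b topology \<Rightarrow> 'x topology \<Rightarrow> 'y topology \<Rightarrow> ('y \<Rightarrow> 'b) \<Rightarrow> nat \<Rightarrow> (nat \<Rightarrow> 'x \<Rightarrow> 'y) \<Rightarrow>
    ('x \<times> 'b \<times> (real \<Rightarrow> 'y)) topology" where
  "path_pullback B X Y pY r f =
     pullback_space X (path_space B Y pY) (tuple_map r f) (path_eval r)"

definition path_pullback_map :: "'x \<times> 'b \<times> (real \<Rightarrow> 'y) \<Rightarrow> 'x" where
  "path_pullback_map = fst"

text \<open>The pullback is a fibrewise space over \<open>B\<close> through \<open>X\<close>.\<close>

definition path_pullback_proj :: "('x \<Rightarrow> 'b) \<Rightarrow> 'x \<times> 'b \<times> (real \<Rightarrow> 'y) \<Rightarrow> 'b" where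
  "path_pullback_proj pX = pX \<circ> path_pullback_map"


section \<open>Consistency of the definitions\<close>

lemma topspace_compact_open: "topspace (compact_open_topology X Y) = mapping_space X Y"
proof -
  have "mapping_space X Y \<in> {{f \<in> mapping_space X Y. f ` K \<subseteq> V} | K V. compactin X K \<and> openin Y V}"
    by (rule CollectI, rule exI[of _ "{}"], rule exI[of _ "topspace Y"]) auto
  then show ?thesis
    unfolding compact_open_topology_def topology_generated_by_topspace by blast
qed

lemma topspace_path_space:
  "topspace (path_space B Y pY) =
     {(b, \<gamma>). b \<in> topspace B \<and> \<gamma> \<in> mapping_space (top_of_set {0..1}) Y \<and>
              (\<forall>t\<in>{0..1}. pY (\<gamma> t) = b)}"
  by (auto simp: path_space_def topspace_compact_open)

lemma topspace_path_pullback: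
  fixes f :: "nat \<Rightarrow> 'x \<Rightarrow> 'y" and pY :: "'y \<Rightarrow> 'b"
  shows "topspace (path_pullback B X Y pY r f) =
     {(x, b, \<gamma>). x \<in> topspace X \<and> (b, \<gamma>) \<in> topspace (path_space B Y pY) \<and>
                 (\<forall>i<r. f (Suc i) x = \<gamma> (real i / (real r - 1)))}"
proof -
  have "(tuple_map r f x = path_eval r (b, \<gamma>)) \<longleftrightarrow>
        (\<forall>i<r. f (Suc i) x = \<gamma> (real i / (real r - 1)))" for x and b :: 'b and \<gamma>
  proof -
    have "(tuple_map r f x = path_eval r (b, \<gamma>)) \<longleftrightarrow>
          (\<forall>i\<in>{1..r}. f i x = \<gamma> ((real i - 1) / (real r - 1)))"
      unfolding tuple_map_def path_eval_def by (auto simp: restrict_def fun_eq_iff)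
    also have "\<dots> \<longleftrightarrow> (\<forall>i\<in>Suc ` {..<r}. f i x = \<gamma> ((real i - 1) / (real r - 1)))"
      by (simp only: image_Suc_lessThan)
    finally show ?thesis by auto
  qed
  then show ?thesis
    by (auto simp: path_pullback_def pullback_space_def)
qed

lemma continuous_map_path_eval:
  assumes "r \<ge> 2"
  shows "continuous_map (path_space B Y pY) (fibred_power Y pY r) (path_eval r)"
proof -
  let ?I = "top_of_set {0..1::real}" and ?P = "path_space B Y pY"
  have t: "(real i - 1) / (real r - 1) \<in> {0..1}" if "i \<in> {1..r}" for i
    using that assms by (auto simp: divide_simps)
  have ev: "continuous_map (compact_open_topology ?I Y) Y (\<lambda>\<gamma>. \<gamma> t)" if t: "t \<in> {0..1}" for t
    unfolding continuous_map_def
  proof (intro conjI allI impI)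
    show "(\<lambda>\<gamma>. \<gamma> t) \<in> topspace (compact_open_topology ?I Y) \<rightarrow> topspace Y"
      using t by (auto simp: topspace_compact_open mapping_space_def continuous_map_def)
    fix V assume V: "openin Y V"
    have "{\<gamma> \<in> mapping_space ?I Y. \<gamma> t \<in> V} = {\<gamma> \<in> mapping_space ?I Y. \<gamma> ` {t} \<subseteq> V}"
      by auto
    moreover have "openin (compact_open_topology ?I Y) \<dots>"
      unfolding compact_open_topology_def
      by (rule topology_generated_by_Basis, rule CollectI, rule exI[of _ "{t}"], rule exI[of _ V])
         (use t V in \<open>simp add: compactin_subtopology\<close>)
    ultimately show "openin (compact_open_topology ?I Y)
        {\<gamma> \<in> topspace (compact_open_topology ?I Y). \<gamma> t \<in> V}"
      by (simp add: topspace_compact_open)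
  qed
  have "continuous_map ?P Y (\<lambda>z. snd z t)" if "t \<in> {0..1}" for t
    using continuous_map_compose[OF continuous_map_snd ev[OF that], of B]
    unfolding path_space_def o_def by (rule continuous_map_from_subtopology)
  then have "continuous_map ?P (product_topology (\<lambda>_. Y) {1..r}) (path_eval r)"
    using t by (auto simp: continuous_map_componentwise path_eval_def case_prod_unfold)
  then show ?thesis
    using t unfolding fibred_power_def continuous_map_in_subtopology
    by (auto simp: path_eval_def topspace_path_space)
qed

lemma continuous_map_tuple_map:
  assumes "\<forall>i\<in>{1..r}. fibrewise_map X pX Y pY (f i)"
  shows "continuous_map X (fibred_power Y pY r) (tuple_map r f)"
  using assms
  by (auto simp: fibred_power_def continuous_map_in_subtopology continuous_map_componentwise
      tuple_map_def fibrewise_map_def)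

lemma fibrewise_map_path_pullback_map:
  "fibrewise_map (path_pullback B X Y pY r f) (path_pullback_proj pX) X pX path_pullback_map"
  by (auto simp: fibrewise_map_def path_pullback_def pullback_space_def path_pullback_map_def
      path_pullback_proj_def continuous_map_fst intro: continuous_map_from_subtopology)

lemma fibrewise_space_path_pullback:
  assumes "fibrewise_space B X pX"
  shows "fibrewise_space B (path_pullback B X Y pY r f) (path_pullback_proj pX)"
  using assms fibrewise_map_path_pullback_map[of B X Y pY r f pX]
  unfolding fibrewise_space_def fibrewise_map_def path_pullback_proj_def
  by (blast intro: continuous_map_compose)

lemma path_pullback_proj_eq:
  assumes "r \<ge> 2" "\<forall>i\<in>{1..r}. fibrewise_map X pX Y pY (f i)"
    and "(x, b, \<gamma>) \<in> topspace (path_pullback B X Y pY r f)"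
  shows "path_pullback_proj pX (x, b, \<gamma>) = b"
proof -
  have "f (Suc 0) x = \<gamma> 0" "x \<in> topspace X" "pY (\<gamma> 0) = b"
    using assms by (force simp: topspace_path_pullback topspace_path_space)+
  moreover have "Suc 0 \<in> {1..r}" using assms(1) by auto
  ultimately show ?thesis
    using assms(2) unfolding fibrewise_map_def path_pullback_proj_def path_pullback_map_def
    by (metis comp_apply fst_conv)
qed

end

theory Submission
  imports Defs
begin

text \<open>
  Both invariants are infima of the same kind of set: the \<open>n\<close> for which \<open>X\<close> has a cover by \<open>n + 1\<close>
  open sets with a certain local property. The theorem holds because the two local properties agree
  on every single \<open>U \<subseteq> X\<close>, so that exactly the same covers are admissible on both sides
  (lemma \<open>section_iff_homotopic\<close>).

  A family of homotopies \<open>f\<^sub>1 \<simeq> f\<^sub>2 \<simeq> \<dots> \<simeq> f\<^sub>r\<close> over \<open>U\<close> can be run one after another. This yields for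
  every \<open>x \<in> U\<close> a path in the fibre over \<open>pX x\<close> that is at \<open>f\<^sub>i x\<close> at the \<open>i\<close>-th of \<open>r\<close> equidistant
  times (lemma \<open>fibrewise_homotopies_concat\<close>), that is, a point of the pullback over \<open>x\<close>. The point
  depends continuously on \<open>x\<close> because a map \<open>Z \<times> X \<rightarrow> Y\<close> has a continuous adjoint into the
  compact-open topology (lemma \<open>continuous_map_curry\<close>), and so there is a strict section over \<open>U\<close>.

  Conversely, let \<open>s\<close> be a section up to homotopy, with \<open>\<sigma>\<close> its first component and \<open>\<gamma>\<^sub>x\<close> the path
  that is the last component of \<open>s x\<close>. Moving along \<open>\<gamma>\<^sub>x\<close> from one of the distinguished times to
  another is a homotopy from \<open>f\<^sub>i \<circ> \<sigma>\<close> to \<open>f\<^sub>j \<circ> \<sigma>\<close>. Its continuity is that of evaluation on the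
  compact-open topology, for which the local compactness of the interval is essential
  (lemma \<open>continuous_map_eval\<close>). Since \<open>\<sigma>\<close> is fibrewise homotopic to the inclusion of \<open>U\<close>, so are
  \<open>f\<^sub>i \<circ> \<sigma>\<close> and \<open>f\<^sub>i\<close>, and \<open>f\<^sub>i \<simeq> f\<^sub>j\<close> over \<open>U\<close> follows.
\<close>

section \<open>The exponential law for the compact-open topology\<close>

text \<open>
  This is the tube lemma: if \<open>G (z, -)\<close> maps a compact \<open>K\<close> into \<open>V\<close>, then so does \<open>G (z', -)\<close> for
  all \<open>z'\<close> in a neighbourhood of \<open>z\<close>.
\<close>

lemma continuous_map_curry:
  assumes G: "continuous_map (prod_topology Z X) Y G"
  shows "continuous_map Z (compact_open_topology X Y) (\<lambda>z. \<lambda>x\<in>topspace X. G (z, x))"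
    (is "continuous_map _ _ ?g")
proof -
  have maps: "?g z \<in> mapping_space X Y" if "z \<in> topspace Z" for z
  proof -
    have "continuous_map X Y (G \<circ> (\<lambda>x. (z, x)))"
      by (rule continuous_map_compose[OF _ G]) (simp add: continuous_map_pairwise o_def that)
    then have "continuous_map X Y (?g z)"
      by (rule continuous_map_eq) simp
    then show ?thesis
      by (simp add: mapping_space_def)
  qed
  show ?thesis
    unfolding compact_open_topology_def
  proof (rule continuous_on_generated_topo)
    show "?g ` topspace Z \<subseteq>
        \<Union> {{f \<in> mapping_space X Y. f ` K \<subseteq> V} | K V. compactin X K \<and> openin Y V}"
      using maps topspace_compact_open[of X Y]
      unfolding compact_open_topology_def topology_generated_by_topspace by auto
  next
    fix W
    assume "W \<in> {{f \<in> mapping_space X Y. f ` K \<subseteq> V} | K V. compactin X K \<and> openin Y V}"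
    then obtain K V where K: "compactin X K" and V: "openin Y V"
      and W: "W = {f \<in> mapping_space X Y. f ` K \<subseteq> V}"
      by blast
    have KX: "K \<subseteq> topspace X"
      using K by (rule compactin_subset_topspace)
    let ?O = "{p \<in> topspace (prod_topology Z X). G p \<in> V}"
    have O: "openin (prod_topology Z X) ?O"
      using G V by (rule openin_continuous_map_preimage)
    show "openin Z (?g -` W \<inter> topspace Z)"
    proof (subst openin_subopen, intro ballI)
      fix z assume z: "z \<in> ?g -` W \<inter> topspace Z"
      then have "{z} \<times> K \<subseteq> ?O"
        using KX by (auto simp: W image_subset_iff subset_iff)
      then obtain U U' where U: "openin Z U" "z \<in> U" "K \<subseteq> U'" "U \<times> U' \<subseteq> ?O"
        using tube_lemma_right[OF O K, of z] z by auto
      then have "U \<subseteq> ?g -` W \<inter> topspace Z"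
        using maps KX openin_subset[OF U(1)] by (auto simp: W)
      with U show "\<exists>T. openin Z T \<and> z \<in> T \<and> T \<subseteq> ?g -` W \<inter> topspace Z"
        by blast
    qed
  qed
qed

text \<open>
  Near \<open>(\<gamma>, x)\<close> with \<open>\<gamma> x \<in> V\<close> the neighbourhood is the set of all \<open>(\<delta>, x')\<close> for which \<open>x'\<close> lies in
  the interior of a compact neighbourhood \<open>K\<close> of \<open>x\<close> with \<open>\<gamma> ` K \<subseteq> V\<close>, and \<open>\<delta> ` K \<subseteq> V\<close>.
\<close>

lemma continuous_map_eval:
  assumes base: "neighbourhood_base_of (compactin X) X"
  shows "continuous_map (prod_topology (compact_open_topology X Y) X) Y (\<lambda>(\<gamma>, x). \<gamma> x)"
    (is "continuous_map ?P Y ?e")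
  unfolding continuous_map_def
proof (intro conjI allI impI)
  show "?e \<in> topspace ?P \<rightarrow> topspace Y"
    by (auto simp: topspace_compact_open mapping_space_def continuous_map_def)
  fix V assume V: "openin Y V"
  show "openin ?P {p \<in> topspace ?P. ?e p \<in> V}"
  proof (subst openin_subopen, intro ballI)
    fix p assume "p \<in> {p \<in> topspace ?P. ?e p \<in> V}"
    then obtain \<gamma> x where p: "p = (\<gamma>, x)" and \<gamma>: "\<gamma> \<in> mapping_space X Y"
      and x: "x \<in> topspace X" "\<gamma> x \<in> V"
      by (auto simp: topspace_compact_open)
    have "openin X {x \<in> topspace X. \<gamma> x \<in> V}"
      using \<gamma> V by (auto simp: mapping_space_def intro: openin_continuous_map_preimage)
    then obtain U K where U: "openin X U" "x \<in> U" "U \<subseteq> K"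
      and K: "compactin X K" "K \<subseteq> {x \<in> topspace X. \<gamma> x \<in> V}"
      using base x unfolding neighbourhood_base_of by (metis (no_types, lifting) mem_Collect_eq)
    let ?N = "{\<delta> \<in> mapping_space X Y. \<delta> ` K \<subseteq> V}"
    have "openin (compact_open_topology X Y) ?N"
      unfolding compact_open_topology_def
      by (rule topology_generated_by_Basis) (use K V in blast)
    then have "openin ?P (?N \<times> U)"
      using U by (simp add: openin_prod_Times_iff)
    moreover have "p \<in> ?N \<times> U"
      using p \<gamma> U K by auto
    moreover have "?N \<times> U \<subseteq> {p \<in> topspace ?P. ?e p \<in> V}"
      using U openin_subset[OF U(1)] by (auto simp: topspace_compact_open)
    ultimately show "\<exists>T. openin ?P T \<and> p \<in> T \<and> T \<subseteq> {p \<in> topspace ?P. ?e p \<in> V}"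
      by blast
  qed
qed

lemma neighbourhood_base_of_compactin_interval:
  "neighbourhood_base_of (compactin (top_of_set {a..b::real})) (top_of_set {a..b})"
proof (rule locally_compact_imp_neighbourhood_base)
  show "locally_compact_space (top_of_set {a..b})"
    by (intro compact_imp_locally_compact_space) (simp add: compact_space_subtopology)
  show "regular_space (top_of_set {a..b})"
    by (simp add: regular_space_subtopology regular_space_euclidean)
qed


section \<open>Fibrewise homotopies\<close>

lemma fibrewise_homotopic_postcompose:
  assumes "fibrewise_homotopic X pX Y pY f g" and h: "fibrewise_map Y pY Z pZ h"
  shows "fibrewise_homotopic X pX Z pZ (h \<circ> f) (h \<circ> g)"
proof -
  obtain H where H: "continuous_map (prod_topology X (top_of_set {0..1::real})) Y H"
    "\<forall>x\<in>topspace X. \<forall>t\<in>{0..1}. pY (H (x, t)) = pX x"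
    "\<forall>x\<in>topspace X. H (x, 0) = f x" "\<forall>x\<in>topspace X. H (x, 1) = g x"
    using assms(1) unfolding fibrewise_homotopic_iff by blast
  have mem: "H (x, t) \<in> topspace Y" if "x \<in> topspace X" "t \<in> {0..1}" for x t
    using continuous_map_image_subset_topspace[OF H(1)] that by force
  have "continuous_map (prod_topology X (top_of_set {0..1::real})) Z (h \<circ> H)"
    using H(1) h unfolding fibrewise_map_def by (blast intro: continuous_map_compose)
  with H mem h show ?thesis
    unfolding fibrewise_homotopic_iff by (intro exI[of _ "h \<circ> H"]) (simp add: fibrewise_map_def)
qed

text \<open>
  The homotopies are run one after another, the \<open>i\<close>-th one during the time interval
  \<open>{real i..real (Suc i)}\<close>. This keeps each step of the induction free of rescaling.
\<close>

lemma fibrewise_homotopies_concat: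
  assumes g0: "fibrewise_map X pX Y pY (g 0)"
    and step: "\<And>i. i < n \<Longrightarrow> fibrewise_homotopic X pX Y pY (g i) (g (Suc i))"
  shows "\<exists>G. continuous_map (prod_topology X (top_of_set {0..real n})) Y G \<and>
    (\<forall>x\<in>topspace X. \<forall>t\<in>{0..real n}. pY (G (x, t)) = pX x) \<and>
    (\<forall>i\<le>n. \<forall>x\<in>topspace X. G (x, real i) = g i x)"
  using step
proof (induction n)
  case 0
  have "continuous_map (prod_topology X (top_of_set {0..real 0})) Y (g 0 \<circ> fst)"
    using g0 by (auto simp: fibrewise_map_def intro: continuous_map_compose continuous_map_fst)
  with g0 show ?case
    by (intro exI[of _ "g 0 \<circ> fst"]) (simp add: fibrewise_map_def o_def)
next
  case (Suc n)
  obtain G where G: "continuous_map (prod_topology X (top_of_set {0..real n})) Y G"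
    "\<And>x t. x \<in> topspace X \<Longrightarrow> t \<in> {0..real n} \<Longrightarrow> pY (G (x, t)) = pX x"
    "\<And>i x. i \<le> n \<Longrightarrow> x \<in> topspace X \<Longrightarrow> G (x, real i) = g i x"
    using Suc.IH Suc.prems by (auto simp: less_Suc_eq)
  obtain H where H: "continuous_map (prod_topology X (top_of_set {0..1::real})) Y H"
    "\<And>x t. x \<in> topspace X \<Longrightarrow> t \<in> {0..1} \<Longrightarrow> pY (H (x, t)) = pX x"
    "\<And>x. x \<in> topspace X \<Longrightarrow> H (x, 0) = g n x"
    "\<And>x. x \<in> topspace X \<Longrightarrow> H (x, 1) = g (Suc n) x"
    using Suc.prems[of n] unfolding fibrewise_homotopic_iff by auto
  let ?P = "prod_topology X (top_of_set {0..real (Suc n)})"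
  let ?h = "\<lambda>p. (fst p, snd p - real n)"
  let ?F = "\<lambda>p. if snd p \<le> real n then G p else (H \<circ> ?h) p"
  have snd: "continuous_map ?P euclideanreal snd"
    using continuous_map_snd continuous_map_in_subtopology by blast
  have sub1: "continuous_map (subtopology ?P S) X fst" for S
    by (intro continuous_map_from_subtopology continuous_map_fst)
  have sub2: "continuous_map (subtopology ?P S) euclideanreal snd" for S
    by (intro continuous_map_from_subtopology snd)
  have "continuous_map ?P Y ?F"
  proof (rule continuous_map_cases_le)
    show "continuous_map ?P euclideanreal snd"
      by (rule snd)
    show "continuous_map ?P euclideanreal (\<lambda>x. real n)"
      by simp
    have "continuous_map (subtopology ?P {p \<in> topspace ?P. snd p \<le> real n})
        (prod_topology X (top_of_set {0..real n})) id"
      unfolding continuous_map_pairwise continuous_map_in_subtopology id_def o_def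
      using sub1 sub2 by auto
    from continuous_map_compose[OF this G(1)]
    show "continuous_map (subtopology ?P {p \<in> topspace ?P. snd p \<le> real n}) Y G"
      by simp
    have "continuous_map (subtopology ?P {p \<in> topspace ?P. real n \<le> snd p})
        (prod_topology X (top_of_set {0..1})) ?h"
      unfolding continuous_map_pairwise continuous_map_in_subtopology o_def
      using sub1 sub2 by (auto intro!: continuous_intros)
    from continuous_map_compose[OF this H(1)]
    show "continuous_map (subtopology ?P {p \<in> topspace ?P. real n \<le> snd p}) Y (H \<circ> ?h)" .
    fix p assume "p \<in> topspace ?P" "snd p = real n"
    then show "G p = (H \<circ> ?h) p"
      using G(3)[of n "fst p"] H(3)[of "fst p"] by (cases p) auto
  qed
  moreover have "pY (?F (x, t)) = pX x" if "x \<in> topspace X" "t \<in> {0..real (Suc n)}" for x t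
    using that G(2) H(2) by auto
  moreover have "?F (x, real i) = g i x" if "i \<le> Suc n" "x \<in> topspace X" for i x
    using that G(3) H(4) by (cases "i = Suc n") auto
  ultimately show ?case
    by (intro exI[of _ ?F]) blast
qed


section \<open>Local sections of the pulled back path fibration\<close>

text \<open>
  The paths arise from a concatenation of homotopies over \<open>{0..r - 1}\<close>, rescaled to \<open>{0..1}\<close>, which
  puts the value \<open>f\<^sub>i x\<close> at the time \<open>(i - 1) / (r - 1)\<close>.
\<close>

lemma section_if_homotopic:
  assumes X: "fibrewise_space B X pX" and r: "r \<ge> 2"
    and f: "\<forall>i\<in>{1..r}. fibrewise_map X pX Y pY (f i)"
    and hom: "\<And>i. i \<in> {1..<r} \<Longrightarrow>
      fibrewise_homotopic (subtopology X U) pX Y pY (f i) (f (Suc i))"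
  shows "\<exists>s. fibrewise_map (subtopology X U) pX (path_pullback B X Y pY r f)
      (path_pullback_proj pX) s \<and> (\<forall>x. path_pullback_map (s x) = x)"
proof -
  let ?U = "subtopology X U" and ?I = "top_of_set {0..1::real}"
  have "fibrewise_map ?U pX Y pY (f (Suc 0))"
    using f r by (auto simp: fibrewise_map_def continuous_map_from_subtopology)
  then obtain G where G: "continuous_map (prod_topology ?U (top_of_set {0..real (r - 1)})) Y G"
    "\<And>x t. x \<in> topspace ?U \<Longrightarrow> t \<in> {0..real (r - 1)} \<Longrightarrow> pY (G (x, t)) = pX x"
    "\<And>i x. i \<le> r - 1 \<Longrightarrow> x \<in> topspace ?U \<Longrightarrow> G (x, real i) = f (Suc i) x"
    using fibrewise_homotopies_concat[of ?U pX Y pY "\<lambda>i. f (Suc i)" "r - 1"] hom by force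
  let ?c = "\<lambda>p. (fst p, real (r - 1) * snd p)"
  define \<gamma> where "\<gamma> = (\<lambda>x. \<lambda>t\<in>topspace ?I. (G \<circ> ?c) (x, t))"
  define s where "s = (\<lambda>x. (x, pX x, \<gamma> x))"
  have "continuous_map (prod_topology ?U ?I) euclideanreal snd"
    using continuous_map_snd continuous_map_in_subtopology by blast
  then have "continuous_map (prod_topology ?U ?I)
      (prod_topology ?U (top_of_set {0..real (r - 1)})) ?c"
    unfolding continuous_map_pairwise continuous_map_in_subtopology o_def
    using continuous_map_fst[of ?U ?I]
    by (auto intro!: continuous_intros simp: continuous_map_in_subtopology mult_left_le)
  from continuous_map_curry[OF continuous_map_compose[OF this G(1)]]
  have \<gamma>: "continuous_map ?U (compact_open_topology ?I Y) \<gamma>"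
    unfolding \<gamma>_def .
  have pX: "continuous_map ?U B pX"
    using X by (simp add: fibrewise_space_def continuous_map_from_subtopology)
  have id: "continuous_map ?U X (\<lambda>x. x)"
    by (intro continuous_map_from_subtopology) simp
  have fib: "pY (\<gamma> x t) = pX x" if "x \<in> topspace ?U" "t \<in> {0..1}" for x t
    using that G(2)[of x "real (r - 1) * t"] by (simp add: \<gamma>_def mult_left_le)
  have val: "f i x = \<gamma> x ((real i - 1) / (real r - 1))" if "x \<in> topspace ?U" "i \<in> {1..r}" for x i
  proof -
    have "(real i - 1) / (real r - 1) \<in> {0..1}"
      using that r by (auto simp: divide_simps)
    moreover have "real (r - 1) * ((real i - 1) / (real r - 1)) = real (i - 1)"
      using that r by simp
    ultimately show ?thesis
      using G(3)[of "i - 1" x] that diff_le_mono[of i r 1]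
      by (simp add: \<gamma>_def del: of_nat_diff of_nat_diff_if)
  qed
  have "continuous_map ?U (path_space B Y pY) (\<lambda>x. (pX x, \<gamma> x))"
    using pX \<gamma> fib
    by (auto simp: path_space_def continuous_map_in_subtopology continuous_map_pairwise o_def)
  moreover have "tuple_map r f x = path_eval r (pX x, \<gamma> x)" if "x \<in> topspace ?U" for x
    unfolding tuple_map_def path_eval_def using val[OF that] by (auto simp: restrict_def)
  ultimately have "continuous_map ?U (path_pullback B X Y pY r f) s"
    using id by (auto simp: path_pullback_def pullback_space_def continuous_map_in_subtopology
        continuous_map_pairwise o_def s_def)
  then have "fibrewise_map ?U pX (path_pullback B X Y pY r f) (path_pullback_proj pX) s"
    by (simp add: fibrewise_map_def path_pullback_proj_def path_pullback_map_def s_def)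
  then show ?thesis
    by (intro exI[of _ s]) (simp add: path_pullback_map_def s_def)
qed

text \<open>
  Evaluating the path in \<open>s x\<close> at a time that moves linearly from \<open>(i - 1) / (r - 1)\<close> to
  \<open>(j - 1) / (r - 1)\<close> is the homotopy.
\<close>

lemma homotopic_along_paths:
  assumes r: "r \<ge> 2" and f: "\<forall>i\<in>{1..r}. fibrewise_map X pX Y pY (f i)"
    and s: "fibrewise_map Z pZ (path_pullback B X Y pY r f) (path_pullback_proj pX) s"
    and ij: "i \<in> {1..r}" "j \<in> {1..r}"
  shows "fibrewise_homotopic Z pZ Y pY (f i \<circ> (path_pullback_map \<circ> s))
    (f j \<circ> (path_pullback_map \<circ> s))"
proof -
  let ?I = "top_of_set {0..1::real}" and ?C = "compact_open_topology (top_of_set {0..1::real}) Y"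
  define \<tau> where "\<tau> k = (real k - 1) / (real r - 1)" for k :: nat
  define \<theta> where "\<theta> u = (1 - u) * \<tau> i + u * \<tau> j" for u
  define \<gamma> where "\<gamma> x = snd (snd (s x))" for x
  have \<tau>: "\<tau> k \<in> {0..1}" if "k \<in> {1..r}" for k
    using that r by (auto simp: \<tau>_def divide_simps)
  have \<theta>: "\<theta> u \<in> {0..1}" if "u \<in> {0..1}" for u
    using convexD_alt[OF convex_real_interval(5)[of 0 1] \<tau>[OF ij(1)] \<tau>[OF ij(2)], of u] that
    by (simp add: \<theta>_def)
  have s_cont: "continuous_map Z (path_pullback B X Y pY r f) s"
    using s by (simp add: fibrewise_map_def)
  have "continuous_map (path_pullback B X Y pY r f) ?C (snd \<circ> snd)"
    unfolding path_pullback_def pullback_space_def path_space_def prod_topology_subtopology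
      subtopology_subtopology
    by (intro continuous_map_from_subtopology
        continuous_map_compose[OF continuous_map_snd continuous_map_snd])
  from continuous_map_compose[OF s_cont this] have \<gamma>: "continuous_map Z ?C \<gamma>"
    by (simp add: o_def \<gamma>_def[abs_def])
  have "continuous_map ?I ?I \<theta>"
    unfolding continuous_map_in_subtopology
    using \<theta> by (auto simp: \<theta>_def intro!: continuous_intros)
  with \<gamma> have "continuous_map (prod_topology Z ?I) (prod_topology ?C ?I)
      (\<lambda>p. (\<gamma> (fst p), \<theta> (snd p)))"
    by (auto simp: continuous_map_pairwise o_def continuous_map_of_fst[unfolded o_def]
        continuous_map_of_snd[unfolded o_def])
  from continuous_map_compose[OF this
      continuous_map_eval[OF neighbourhood_base_of_compactin_interval]]
  have H: "continuous_map (prod_topology Z ?I) Y (\<lambda>p. \<gamma> (fst p) (\<theta> (snd p)))"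
    by (simp add: o_def)
  have pt: "(\<forall>t\<in>{0..1}. pY (\<gamma> x t) = pZ x) \<and>
      (\<forall>k\<in>{1..r}. \<gamma> x (\<tau> k) = f k (path_pullback_map (s x)))" if x: "x \<in> topspace Z" for x
  proof -
    obtain a b \<delta> where sx: "s x = (a, b, \<delta>)"
      by (cases "s x")
    have mem: "(a, b, \<delta>) \<in> topspace (path_pullback B X Y pY r f)"
      using continuous_map_image_subset_topspace[OF s_cont] x sx by force
    have "pZ x = b"
      using path_pullback_proj_eq[OF r f mem] s x sx unfolding fibrewise_map_def by metis
    moreover have "\<delta> (\<tau> k) = f k a" if "k \<in> {1..r}" for k
    proof -
      have "\<forall>i<r. f (Suc i) a = \<delta> (real i / (real r - 1))"
        using mem by (simp add: topspace_path_pullback)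
      moreover have "k - 1 < r"
        using that by auto
      ultimately have "f (Suc (k - 1)) a = \<delta> (real (k - 1) / (real r - 1))"
        by blast
      with that show ?thesis
        by (simp add: \<tau>_def)
    qed
    ultimately show ?thesis
      using mem by (simp add: sx \<gamma>_def path_pullback_map_def topspace_path_pullback
          topspace_path_space)
  qed
  show ?thesis
    unfolding fibrewise_homotopic_iff
    using H pt \<theta> ij by (intro exI[of _ "\<lambda>p. \<gamma> (fst p) (\<theta> (snd p))"]) (auto simp: \<theta>_def)
qed

lemma section_iff_homotopic:
  assumes X: "fibrewise_space B X pX" and r: "r \<ge> 2"
    and f: "\<forall>i\<in>{1..r}. fibrewise_map X pX Y pY (f i)"
  shows "(\<exists>s. fibrewise_map (subtopology X U) pX (path_pullback B X Y pY r f)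
        (path_pullback_proj pX) s \<and>
        fibrewise_homotopic (subtopology X U) pX X pX (path_pullback_map \<circ> s) (\<lambda>x. x)) \<longleftrightarrow>
    (\<forall>s\<in>{1..r}. \<forall>t\<in>{1..r}. fibrewise_homotopic (subtopology X U) pX Y pY (f s) (f t))"
    (is "(\<exists>s. ?sec s \<and> ?near s) \<longleftrightarrow> ?R")
proof
  assume "\<exists>s. ?sec s \<and> ?near s"
  then obtain \<sigma> where \<sigma>: "?sec \<sigma>" "?near \<sigma>"
    by blast
  have near: "fibrewise_homotopic (subtopology X U) pX Y pY (f i \<circ> (path_pullback_map \<circ> \<sigma>)) (f i)"
    if "i \<in> {1..r}" for i
    using fibrewise_homotopic_postcompose[OF \<sigma>(2)] f that by (fastforce simp: o_def)
  show ?R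
  proof (intro ballI)
    fix i j assume ij: "i \<in> {1..r}" "j \<in> {1..r}"
    show "fibrewise_homotopic (subtopology X U) pX Y pY (f i) (f j)"
      using near[OF ij(1)] homotopic_along_paths[OF r f \<sigma>(1) ij] near[OF ij(2)]
      unfolding fibrewise_homotopic_def by (meson homotopic_with_symD homotopic_with_trans)
  qed
next
  assume R: ?R
  then have "fibrewise_homotopic (subtopology X U) pX Y pY (f i) (f (Suc i))"
    if "i \<in> {1..<r}" for i
    using that by auto
  from section_if_homotopic[OF X r f this]
  obtain s where s: "?sec s" "\<forall>x. path_pullback_map (s x) = x"
    by blast
  then have "path_pullback_map \<circ> s = (\<lambda>x. x)"
    by auto
  then have "?near s"
    by (simp add: fibrewise_homotopic_def continuous_map_from_subtopology)
  with s show "\<exists>s. ?sec s \<and> ?near s"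
    by blast
qed

theorem proposition4p2:
  fixes B :: "'b topology" and X :: "'x topology" and Y :: "'y topology"
    and pX :: "'x \<Rightarrow> 'b" and pY :: "'y \<Rightarrow> 'b"
    and r :: nat and f :: "nat \<Rightarrow> 'x \<Rightarrow> 'y"
  assumes "fibrewise_space B X pX" and "fibrewise_space B Y pY"
    and "r \<ge> 2"
    and "\<forall>i\<in>{1..r}. fibrewise_map X pX Y pY (f i)"
  shows "fibrewise_distance X pX Y pY r f =
    fibrewise_secat (path_pullback B X Y pY r f) (path_pullback_proj pX) X pX path_pullback_map"
  unfolding fibrewise_distance_def fibrewise_secat_def
    section_iff_homotopic[OF assms(1,3,4)] ..

end
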